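(* Let $p\in[0,1]$, $\lambda>0$ and $\mu>0$. Consider $N\ge 4$ servers distributed independently and uniformly in $[0,1]$ with exogenous arrivals of rate $\lambda$ following the $(1,p)$-NNS strategy and having a service rate $\mu$. If $\frac{1}{1+p}<\frac{\lambda}{\mu}\le 1$, then the expected fraction of overloaded servers is $\mathbb{E}\,\mathcal{O}_N=\frac14$.
   Context: Servers: $X_1,\dots,X_N$ are i.i.d. uniformly distributed on $[0,1]$; server $i$ (with its own infinite-capacity queue) is located at $X_i$. Almost surely all inter-server distances are distinct, so each server has a unique nearest neighbour among the other $N-1$ servers. Arrivals: customers arrive at each queue $i$ according to a stationary arrival process of exogenous rate (intensity) $\lambda$, the processes being mutually independent; each server works at service rate $\mu$. Customers make independent decisions. Under the $(1,p)$-NNS (nearest neighbour shift) strategy, a customer arriving at queue $i$ joins queue $i$ with probability $1-p$, and joins the queue of the nearest neighbour of $i$ with probability $p$. The effective arrival rate $\lambda_{\text{eff}}(i)$ is the rate at which customers join queue $i$, i.e. the sum over all $j\in\{1,\dots,N\}$ of $\lambda$ times the probability that a customer arriving at queue $j$ joins queue $i$. Server $i$ is overloaded if $\lambda_{\text{eff}}(i)>\mu$, and $$\mathcal{O}_N=\frac1N\big|\{i:\lambda_{\text{eff}}(i)>\mu\}\big|,$$ a random variable whose randomness comes from the server locations only. *)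

theory Defs
  imports "HOL-Probability.Probability"
begin

text \<open>
  There are \<open>N\<close> servers, indexed by \<open>{1..N}\<close>, and \<open>x i\<close> is the location of server \<open>i\<close>.
  For pairwise distinct distances (the almost sure case) the minimiser below is unique;
  otherwise \<open>arg_min_on\<close> picks some nearest server.
\<close>

definition nearest_neighbour :: "nat \<Rightarrow> (nat \<Rightarrow> real) \<Rightarrow> nat \<Rightarrow> nat" where
  "nearest_neighbour N x i = arg_min_on (\<lambda>j. dist (x i) (x j)) ({1..N} - {i})"

text \<open>
  The \<open>(1,p)\<close>-NNS strategy: distribution of the queue joined by a customer arriving at queue
  \<open>j\<close>, given the locations \<open>x\<close>.
\<close>

definition nns_join :: "nat \<Rightarrow> real \<Rightarrow> (nat \<Rightarrow> real) \<Rightarrow> nat \<Rightarrow> nat pmf" where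
  "nns_join N p x j =
     map_pmf (\<lambda>shift. if shift then nearest_neighbour N x j else j) (bernoulli_pmf p)"

text \<open>
  The arrival processes enter only through their common intensity \<open>l\<close>: the effective rate at
  queue \<open>i\<close> sums, over all queues \<open>j\<close>, the intensity of the customers arriving at \<open>j\<close> that join \<open>i\<close>.
\<close>

definition effective_rate ::
  "nat \<Rightarrow> real \<Rightarrow> real \<Rightarrow> (nat \<Rightarrow> real) \<Rightarrow> nat \<Rightarrow> real" where
  "effective_rate N p l x i = (\<Sum>j\<in>{1..N}. l * pmf (nns_join N p x j) i)"

definition overloaded_fraction ::
  "nat \<Rightarrow> real \<Rightarrow> real \<Rightarrow> real \<Rightarrow> (nat \<Rightarrow> real) \<Rightarrow> real" where
  "overloaded_fraction N p l m x =
     real (card {i \<in> {1..N}. effective_rate N p l x i > m}) / real N"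

end

theory Submission
  imports Defs
begin

text \<open>
  Let \<open>y\<^sub>1 < \<dots> < y\<^sub>N\<close> be the sorted locations. The nearest neighbour of a server is adjacent to it in
  this order, so every server points to the right or to the left: \<open>s\<^sub>k = 1\<close> or \<open>s\<^sub>k = -1\<close>, and for
  \<open>1 < k < N\<close> this is the sign of \<open>2 y\<^sub>k - y\<^sub>k\<^sub>-\<^sub>1 - y\<^sub>k\<^sub>+\<^sub>1\<close>. A server that is the nearest neighbour of \<open>d\<close>
  others has effective rate \<open>\<lambda> (1 - p + p d)\<close>, where \<open>d \<le> 2\<close>. The hypotheses on \<open>\<lambda> / \<mu>\<close> make it
  overloaded exactly when \<open>d = 2\<close>, that is, when \<open>s\<^sub>k\<^sub>-\<^sub>1 = 1\<close> and \<open>s\<^sub>k\<^sub>+\<^sub>1 = -1\<close>.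

  Two fictitious servers outside the row that point outwards, \<open>s\<^sub>0 = -1\<close> and \<open>s\<^sub>N\<^sub>+\<^sub>1 = 1\<close>, make this
  criterion valid at the two ends as well. The number of overloaded servers is therefore
  \<open>\<Sum>\<^sub>k (1 + s\<^sub>k\<^sub>-\<^sub>1) (1 - s\<^sub>k\<^sub>+\<^sub>1) / 4\<close>. The linear terms telescope to zero, which leaves
  \<open>N / 4 - (\<Sum>\<^sub>k s\<^sub>k\<^sub>-\<^sub>1 s\<^sub>k\<^sub>+\<^sub>1) / 4\<close> (lemma \<open>overloaded_fraction_eq_directions\<close>).

  Each product \<open>s\<^sub>k\<^sub>-\<^sub>1 s\<^sub>k\<^sub>+\<^sub>1\<close> has mean zero. Indeed, as \<open>N \<ge> 4\<close>, one of the two servers, say the one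
  of rank \<open>c\<close>, is interior. Reflecting its location in the midpoint of its two neighbours keeps the
  order and the measure, changes the sign of \<open>s\<^sub>c\<close>, and leaves the direction of the server of rank
  \<open>c \<plusminus> 2\<close> alone, because that direction does not involve \<open>y\<^sub>c\<close>
  (lemma \<open>integral_sorted_direction_product\<close>). Only one coordinate moves, so Fubini's theorem and the
  reflection invariance of Lebesgue measure on the line suffice. Which coordinate this is depends
  on the permutation \<open>\<sigma>\<close> that sorts the locations, and so the cancellation takes place separately in
  the region of each \<open>\<sigma>\<close>.
\<close>

section \<open>Directions and overload for sorted locations\<close>

text \<open>
  The servers of rank \<open>1\<close> and \<open>N\<close> have a neighbour on one side only. Ranks \<open>0\<close> and \<open>N + 1\<close> are
  fictitious servers that point away from the row, so that they never contribute to an end server.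
  With these values the differences of the directions at \<open>k - 1\<close> and \<open>k + 1\<close> sum to zero over all \<open>k\<close>.
\<close>

definition direction :: "nat \<Rightarrow> (nat \<Rightarrow> real) \<Rightarrow> nat \<Rightarrow> real" where
  "direction N y k =
     (if k = 1 \<or> N < k then 1 else if k = 0 \<or> k = N then - 1
      else sgn (2 * y k - (y (k - 1) + y (k + 1))))"

definition neighbour_rank :: "nat \<Rightarrow> (nat \<Rightarrow> real) \<Rightarrow> nat \<Rightarrow> nat" where
  "neighbour_rank N y k = (if direction N y k = 1 then k + 1 else k - 1)"

text \<open>
  The indices \<open>i\<close> and \<open>j\<close> may coincide; the condition then says that \<open>x k \<noteq> x i\<close>. One condition thus
  covers both coinciding servers and servers with two nearest neighbours.
\<close>

definition tie_free :: "nat \<Rightarrow> (nat \<Rightarrow> real) \<Rightarrow> bool" where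
  "tie_free N x \<longleftrightarrow>
     (\<forall>k\<in>{1..N}. \<forall>i\<in>{1..N} - {k}. \<forall>j\<in>{1..N} - {k}. 2 * x k \<noteq> x i + x j)"

lemma direction_cases:
  assumes "tie_free N y"
  shows "direction N y k = 1 \<or> direction N y k = -1"
proof (cases "2 \<le> k \<and> k < N")
  case True
  then have "k \<in> {1..N}" "k - 1 \<in> {1..N} - {k}" "k + 1 \<in> {1..N} - {k}"
    by auto
  then have "2 * y k \<noteq> y (k - 1) + y (k + 1)"
    using assms unfolding tie_free_def by blast
  then show ?thesis by (auto simp: direction_def sgn_if)
qed (auto simp: direction_def)

text \<open>
  On each side the closest server is the adjacent one, so only the two adjacent gaps compete, and
  the sign of their difference is the direction.
\<close>

lemma nearest_rank:
  assumes N: "2 \<le> N" and mono: "strict_mono_on {1..N} y" and free: "tie_free N y"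
    and k: "k \<in> {1..N}"
  shows "neighbour_rank N y k \<in> {1..N} - {k}"
    and "j \<in> {1..N} - {k} \<Longrightarrow> j \<noteq> neighbour_rank N y k \<Longrightarrow>
      dist (y k) (y (neighbour_rank N y k)) < dist (y k) (y j)"
proof -
  let ?n = "neighbour_rank N y k"
  show "?n \<in> {1..N} - {k}"
    using N k by (auto simp: neighbour_rank_def direction_def)
  have less: "y a < y b" if "1 \<le> a" "a < b" "b \<le> N" for a b
    using mono that by (auto simp: strict_mono_on_def)
  have le: "y a \<le> y b" if "1 \<le> a" "a \<le> b" "b \<le> N" for a b
    using less[of a b] that by (cases "a = b") auto
  assume j: "j \<in> {1..N} - {k}" "j \<noteq> ?n"
  consider (right) "direction N y k = 1" | (left) "direction N y k = -1"
    using direction_cases[OF free] by blast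
  then show "dist (y k) (y ?n) < dist (y k) (y j)"
  proof cases
    case right
    then have n: "?n = k + 1" and kN: "k < N"
      using k N by (auto simp: neighbour_rank_def direction_def split: if_splits)
    have up: "y k < y (k + 1)" using less[of k "k + 1"] k kN by auto
    show ?thesis
    proof (cases "j < k")
      case True
      then have "2 * y k - (y (k - 1) + y (k + 1)) > 0"
        using right k kN j by (auto simp: direction_def sgn_if split: if_splits)
      moreover have "y j \<le> y (k - 1)" using le[of j "k - 1"] j k True by auto
      ultimately show ?thesis using up by (simp add: n dist_real_def)
    next
      case False
      then have "y (k + 1) < y j" using less[of "k + 1" j] j n by auto
      then show ?thesis using up by (simp add: n dist_real_def)
    qed
  next
    case left
    then have n: "?n = k - 1" and k1: "1 < k"
      using k N by (auto simp: neighbour_rank_def direction_def split: if_splits)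
    have down: "y (k - 1) < y k" using less[of "k - 1" k] k k1 by auto
    show ?thesis
    proof (cases "k < j")
      case True
      then have "2 * y k - (y (k - 1) + y (k + 1)) < 0"
        using left k k1 j by (auto simp: direction_def sgn_if split: if_splits)
      moreover have "y (k + 1) \<le> y j" using le[of "k + 1" j] j k True by auto
      ultimately show ?thesis using down by (simp add: n dist_real_def)
    next
      case False
      then have "y j < y (k - 1)" using less[of j "k - 1"] j n k by auto
      then show ?thesis using down by (simp add: n dist_real_def)
    qed
  qed
qed

lemma nearest_neighbour_sorting_perm:
  assumes "2 \<le> N" "\<sigma> permutes {1..N}" "strict_mono_on {1..N} (x \<circ> \<sigma>)" "tie_free N (x \<circ> \<sigma>)"
    and k: "k \<in> {1..N}"
  shows "nearest_neighbour N x (\<sigma> k) = \<sigma> (neighbour_rank N (x \<circ> \<sigma>) k)"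
proof -
  let ?n = "neighbour_rank N (x \<circ> \<sigma>) k"
  note nr = nearest_rank[OF assms(1,3,4) k]
  have strict: "dist (x (\<sigma> k)) (x (\<sigma> ?n)) < dist (x (\<sigma> k)) (x i)"
    if i: "i \<in> {1..N} - {\<sigma> k}" "i \<noteq> \<sigma> ?n" for i
  proof -
    obtain j where j: "i = \<sigma> j" "j \<in> {1..N}"
      using i permutes_image[OF assms(2)] by (metis DiffD1 imageE)
    then show ?thesis using nr(2)[of j] i by auto
  qed
  have mem: "\<sigma> ?n \<in> {1..N} - {\<sigma> k}"
    using nr(1) permutes_in_image[OF assms(2)] permutes_inj[OF assms(2)] by (auto dest: injD)
  show ?thesis
    unfolding nearest_neighbour_def arg_min_on_def arg_min_def is_arg_min_linorder
  proof (rule some_equality)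
    show "\<sigma> ?n \<in> {1..N} - {\<sigma> k} \<and> (\<forall>i. i \<in> {1..N} - {\<sigma> k} \<longrightarrow>
        dist (x (\<sigma> k)) (x (\<sigma> ?n)) \<le> dist (x (\<sigma> k)) (x i))"
      using mem strict by (metis less_imp_le order_refl)
  next
    fix i assume "i \<in> {1..N} - {\<sigma> k} \<and> (\<forall>j. j \<in> {1..N} - {\<sigma> k} \<longrightarrow>
        dist (x (\<sigma> k)) (x i) \<le> dist (x (\<sigma> k)) (x j))"
    then show "i = \<sigma> ?n" using mem strict by (metis not_less)
  qed
qed

text \<open>
  A customer stays with probability \<open>1 - p\<close>, and every server whose nearest neighbour is \<open>i\<close> sends a
  share \<open>p\<close> of its customers to \<open>i\<close>.
\<close>

lemma effective_rate_eq_indegree: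
  assumes "0 \<le> p" "p \<le> 1" "i \<in> {1..N}"
  shows "effective_rate N p l x i =
    l * (1 - p + p * real (card {j \<in> {1..N}. nearest_neighbour N x j = i}))"
proof -
  have "pmf (nns_join N p x j) i =
      (1 - p) * of_bool (j = i) + p * of_bool (nearest_neighbour N x j = i)" for j
    using assms unfolding nns_join_def map_pmf_def
    by (simp add: pmf_bind pmf_return indicator_def)
  then have "effective_rate N p l x i = (\<Sum>j\<in>{1..N}. l *
      ((1 - p) * of_bool (j = i) + p * of_bool (nearest_neighbour N x j = i)))"
    by (simp add: effective_rate_def)
  also have "\<dots> = l * ((1 - p) * (\<Sum>j\<in>{1..N}. of_bool (j = i))
        + p * (\<Sum>j\<in>{1..N}. of_bool (nearest_neighbour N x j = i)))"
    by (simp only: sum_distrib_left sum.distrib distrib_left)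
  also have "(\<Sum>j\<in>{1..N}. of_bool (j = i)) = (1::real)"
    using assms by (simp add: of_bool_def)
  also have "(\<Sum>j\<in>{1..N}. of_bool (nearest_neighbour N x j = i)) =
      real (card {j \<in> {1..N}. nearest_neighbour N x j = i})"
    by (simp add: of_bool_def sum.If_cases Int_def)
  finally show ?thesis by simp
qed

text \<open>
  Only the two adjacent servers can point to a server. With at most one of them doing so the rate is
  at most \<open>l \<le> m\<close>, and with both it is \<open>l * (1 + p) > m\<close>. The fictitious servers provide the missing
  adjacent server for \<open>k = 1\<close> and \<open>k = N\<close>; as they point outwards, they add nothing.
\<close>

lemma overloaded_iff_two_incoming:
  assumes "0 \<le> p" "p \<le> 1" "l > 0" "m > 0" "N \<ge> 2"
    and load: "1 / (1 + p) < l / m" "l / m \<le> 1"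
    and \<sigma>: "\<sigma> permutes {1..N}" and mono: "strict_mono_on {1..N} (x \<circ> \<sigma>)"
    and free: "tie_free N (x \<circ> \<sigma>)" and k: "k \<in> {1..N}"
  shows "m < effective_rate N p l x (\<sigma> k) \<longleftrightarrow>
    direction N (x \<circ> \<sigma>) (k - 1) = 1 \<and> direction N (x \<circ> \<sigma>) (k + 1) = -1"
proof -
  let ?s = "direction N (x \<circ> \<sigma>)"
  let ?D = "{j \<in> {1..N}. nearest_neighbour N x j = \<sigma> k}"
  have lm: "l \<le> m" "m < l * (1 + p)" using load assms by (auto simp: field_simps)
  have "{j \<in> {1..N}. neighbour_rank N (x \<circ> \<sigma>) j = k} =
      (if ?s (k - 1) = 1 then {k - 1} else {}) \<union> (if ?s (k + 1) = -1 then {k + 1} else {})"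
    (is "?R = ?R'")
  proof (intro equalityI subsetI)
    fix j assume "j \<in> ?R"
    then show "j \<in> ?R'"
      using direction_cases[OF free, of j] by (auto simp: neighbour_rank_def)
  next
    fix j assume "j \<in> ?R'"
    then consider "j = k - 1" "?s (k - 1) = 1" | "j = k + 1" "?s (k + 1) = -1"
      by (auto split: if_splits)
    then show "j \<in> ?R"
    proof cases
      case 1
      then have "k - 1 \<noteq> 0" using assms(5) by (intro notI) (simp add: direction_def)
      then show ?thesis using 1 k by (auto simp: neighbour_rank_def)
    next
      case 2
      then have "\<not> N < k + 1" by (intro notI) (simp add: direction_def)
      then show ?thesis using 2 k by (auto simp: neighbour_rank_def)
    qed
  qed
  moreover have "?D = \<sigma> ` ?R"
  proof (intro equalityI subsetI)
    fix i assume i: "i \<in> ?D"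
    then obtain j where j: "i = \<sigma> j" "j \<in> {1..N}"
      using permutes_image[OF \<sigma>] by (metis (no_types, lifting) imageE mem_Collect_eq)
    then show "i \<in> \<sigma> ` ?R"
      using i nearest_neighbour_sorting_perm[OF assms(5) \<sigma> mono free, of j] permutes_inj[OF \<sigma>]
      by (auto dest: injD)
  next
    fix i assume "i \<in> \<sigma> ` ?R"
    then show "i \<in> ?D"
      using nearest_neighbour_sorting_perm[OF assms(5) \<sigma> mono free] permutes_in_image[OF \<sigma>]
      by auto
  qed
  moreover have "card (\<sigma> ` ?R) = card ?R"
    using permutes_inj[OF \<sigma>] by (intro card_image) (auto simp: inj_on_def dest: injD)
  ultimately have "card ?D = of_bool (?s (k - 1) = 1) + of_bool (?s (k + 1) = -1)"
    by auto
  moreover have "\<sigma> k \<in> {1..N}" using k permutes_in_image[OF \<sigma>] by auto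
  ultimately have "effective_rate N p l x (\<sigma> k) =
      l * (1 - p + p * (of_bool (?s (k - 1) = 1) + of_bool (?s (k + 1) = -1)))"
    using effective_rate_eq_indegree[OF assms(1,2), of "\<sigma> k" N l x] by simp
  moreover have "l * (1 - p) \<le> m"
  proof -
    have "l * (1 - p) \<le> l * 1" using assms(1,3) by (intro mult_left_mono) auto
    then show ?thesis using lm by simp
  qed
  ultimately show ?thesis using lm
    by (cases "?s (k - 1) = 1"; cases "?s (k + 1) = -1") (simp_all add: algebra_simps)
qed

lemma sum_shift_difference:
  fixes f :: "nat \<Rightarrow> real"
  assumes "1 \<le> N"
  shows "(\<Sum>k=1..N. f (k - 1) - f (k + 1)) = f 0 + f 1 - f N - f (N + 1)"
  using assms by (induction N rule: dec_induct) auto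

text \<open>
  Expanding the indicator \<open>(1 + s\<^sub>k\<^sub>-\<^sub>1) (1 - s\<^sub>k\<^sub>+\<^sub>1) / 4\<close> of an overload leaves only the products of
  directions, since the linear terms telescope to \<open>s\<^sub>0 + s\<^sub>1 - s\<^sub>N - s\<^sub>N\<^sub>+\<^sub>1 = -1 + 1 + 1 - 1 = 0\<close>.
\<close>

lemma overloaded_fraction_eq_directions:
  assumes "0 \<le> p" "p \<le> 1" "l > 0" "m > 0" "N \<ge> 2"
    and load: "1 / (1 + p) < l / m" "l / m \<le> 1"
    and \<sigma>: "\<sigma> permutes {1..N}" and mono: "strict_mono_on {1..N} (x \<circ> \<sigma>)"
    and free: "tie_free N (x \<circ> \<sigma>)"
  shows "overloaded_fraction N p l m x = 1 / 4 -
    (\<Sum>k=1..N. direction N (x \<circ> \<sigma>) (k - 1) * direction N (x \<circ> \<sigma>) (k + 1)) / (4 * real N)"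
proof -
  define s where "s = direction N (x \<circ> \<sigma>)"
  let ?K = "{k \<in> {1..N}. s (k - 1) = 1 \<and> s (k + 1) = -1}"
  have "{i \<in> {1..N}. m < effective_rate N p l x i} = \<sigma> ` ?K"
  proof (intro equalityI subsetI)
    fix i assume i: "i \<in> {i \<in> {1..N}. m < effective_rate N p l x i}"
    then obtain k where "i = \<sigma> k" "k \<in> {1..N}"
      using permutes_image[OF \<sigma>] by (metis (no_types, lifting) imageE mem_Collect_eq)
    then show "i \<in> \<sigma> ` ?K"
      using i overloaded_iff_two_incoming[OF assms(1-5) load \<sigma> mono free, of k, folded s_def] by auto
  next
    fix i assume "i \<in> \<sigma> ` ?K"
    then show "i \<in> {i \<in> {1..N}. m < effective_rate N p l x i}"
      using overloaded_iff_two_incoming[OF assms(1-5) load \<sigma> mono free, folded s_def] permutes_in_image[OF \<sigma>]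
      by auto
  qed
  moreover have "card (\<sigma> ` ?K) = card ?K"
    using permutes_inj[OF \<sigma>] by (intro card_image) (auto simp: inj_on_def dest: injD)
  ultimately have "real (card {i \<in> {1..N}. m < effective_rate N p l x i}) = real (card ?K)"
    by simp
  also have "\<dots> = (\<Sum>k=1..N. of_bool (s (k - 1) = 1 \<and> s (k + 1) = -1))"
    by (simp add: of_bool_def sum.If_cases Int_def)
  also have "\<dots> = (\<Sum>k=1..N. (1 + s (k - 1)) * (1 - s (k + 1)) / 4)"
  proof (intro sum.cong refl)
    fix k
    show "of_bool (s (k - 1) = 1 \<and> s (k + 1) = -1) = (1 + s (k - 1)) * (1 - s (k + 1)) / 4"
      using direction_cases[OF free, of "k - 1", folded s_def] direction_cases[OF free, of "k + 1", folded s_def] by auto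
  qed
  also have "\<dots> = (real N + (\<Sum>k=1..N. s (k - 1) - s (k + 1))
      - (\<Sum>k=1..N. s (k - 1) * s (k + 1))) / 4"
    by (simp add: sum_divide_distrib[symmetric] sum.distrib sum_subtractf algebra_simps)
  also have "(\<Sum>k=1..N. s (k - 1) - s (k + 1)) = 0"
    using assms(5) by (subst sum_shift_difference) (auto simp: s_def direction_def)
  finally show ?thesis
    unfolding s_def[symmetric] using assms(5) by (simp add: overloaded_fraction_def field_simps)
qed

section \<open>The sorting permutation\<close>

definition location_rank :: "nat \<Rightarrow> (nat \<Rightarrow> real) \<Rightarrow> nat \<Rightarrow> nat" where
  "location_rank N x i = card {j \<in> {1..N}. x j \<le> x i}"

text \<open>
  A sorting permutation is the inverse of the rank function. This gives its uniqueness below, and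
  inverting the rank function gives its existence.
\<close>

lemma location_rank_sorting_perm:
  fixes x :: "nat \<Rightarrow> real"
  assumes \<sigma>: "\<sigma> permutes {1..N}" and mono: "strict_mono_on {1..N} (x \<circ> \<sigma>)" and k: "k \<in> {1..N}"
  shows "location_rank N x (\<sigma> k) = k"
proof -
  have "{j \<in> {1..N}. x j \<le> x (\<sigma> k)} = \<sigma> ` {1..k}"
  proof (intro equalityI subsetI)
    fix i assume i: "i \<in> {j \<in> {1..N}. x j \<le> x (\<sigma> k)}"
    then have "i \<in> \<sigma> ` {1..N}" using permutes_image[OF \<sigma>] by auto
    then obtain j where j: "i = \<sigma> j" "j \<in> {1..N}" by auto
    have "j \<le> k"
    proof (rule ccontr)
      assume "\<not> j \<le> k"
      then have "x (\<sigma> k) < x (\<sigma> j)"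
        using strict_mono_onD[OF mono k j(2)] by simp
      then show False using i j by simp
    qed
    then show "i \<in> \<sigma> ` {1..k}" using j by auto
  next
    fix i assume "i \<in> \<sigma> ` {1..k}"
    then obtain j where j: "i = \<sigma> j" "1 \<le> j" "j \<le> k" by auto
    then have "x (\<sigma> j) \<le> x (\<sigma> k)"
      using strict_mono_onD[OF mono, of j k] k by (cases "j = k") simp_all
    then show "i \<in> {j \<in> {1..N}. x j \<le> x (\<sigma> k)}"
      using j k permutes_in_image[OF \<sigma>, of j] by auto
  qed
  moreover have "card (\<sigma> ` {1..k}) = k"
    using permutes_inj[OF \<sigma>] by (subst card_image) (auto simp: inj_on_def dest: injD)
  ultimately show ?thesis by (simp add: location_rank_def)
qed

lemma sorting_perm_unique:
  fixes x :: "nat \<Rightarrow> real"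
  assumes "\<sigma> permutes {1..N}" "strict_mono_on {1..N} (x \<circ> \<sigma>)"
    and "\<tau> permutes {1..N}" "strict_mono_on {1..N} (x \<circ> \<tau>)"
  shows "\<sigma> = \<tau>"
proof
  fix k show "\<sigma> k = \<tau> k"
  proof (cases "k \<in> {1..N}")
    case True
    then have "\<tau> k \<in> \<sigma> ` {1..N}"
      using permutes_image[OF assms(1)] permutes_in_image[OF assms(3)] by auto
    then obtain j where j: "\<tau> k = \<sigma> j" "j \<in> {1..N}" by auto
    then show ?thesis
      using location_rank_sorting_perm[OF assms(1,2), of j]
        location_rank_sorting_perm[OF assms(3,4) True] by simp
  next
    case False
    then show ?thesis using assms(1,3) by (simp add: permutes_def)
  qed
qed

lemma sorting_perm_exists:
  fixes x :: "nat \<Rightarrow> real"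
  assumes inj: "inj_on x {1..N}"
  obtains \<sigma> where "\<sigma> permutes {1..N}" "strict_mono_on {1..N} (x \<circ> \<sigma>)"
proof -
  let ?r = "location_rank N x"
  \<comment> \<open>a permutation of a set is the identity outside that set\<close>
  let ?\<rho> = "\<lambda>i. if i \<in> {1..N} then ?r i else i"
  have le: "?r i \<le> ?r j" if "x i \<le> x j" for i j
    unfolding location_rank_def using that by (intro card_mono) auto
  have less: "?r i < ?r j" if "x i < x j" "j \<in> {1..N}" for i j
    unfolding location_rank_def
  proof (rule psubset_card_mono)
    show "{k \<in> {1..N}. x k \<le> x i} \<subset> {k \<in> {1..N}. x k \<le> x j}"
      using that by (intro psubsetI) (auto, metis (mono_tags) atLeastAtMost_iff mem_Collect_eq not_less order_refl)
  qed simp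
  have inj_r: "inj_on ?r {1..N}"
  proof (rule inj_onI)
    fix i j assume "i \<in> {1..N}" "j \<in> {1..N}" "?r i = ?r j"
    then show "i = j" using less[of i j] less[of j i] inj
      by (metis inj_onD less_irrefl linorder_neqE)
  qed
  have "?r i \<in> {1..N}" if i: "i \<in> {1..N}" for i
  proof -
    have "{j \<in> {1..N}. x j \<le> x i} \<noteq> {}" using i by auto
    moreover have "card {j \<in> {1..N}. x j \<le> x i} \<le> card {1..N}"
      by (rule card_mono) auto
    ultimately show ?thesis by (simp add: location_rank_def Suc_le_eq card_gt_0_iff)
  qed
  then have "bij_betw ?r {1..N} {1..N}"
    using inj_r by (intro bij_betw_imageI endo_inj_surj) auto
  moreover have "bij_betw ?r {1..N} {1..N} \<longleftrightarrow> bij_betw ?\<rho> {1..N} {1..N}"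
    by (rule bij_betw_cong) simp
  ultimately have \<rho>: "?\<rho> permutes {1..N}"
    by (intro bij_imp_permutes) auto
  define \<sigma> where "\<sigma> = inv ?\<rho>"
  have \<sigma>: "\<sigma> permutes {1..N}" unfolding \<sigma>_def by (rule permutes_inv[OF \<rho>])
  have r\<sigma>: "?r (\<sigma> k) = k" if "k \<in> {1..N}" for k
    using permutes_inverses(1)[OF \<rho>, of k, folded \<sigma>_def] permutes_in_image[OF \<sigma>, of k] that by simp
  have "strict_mono_on {1..N} (x \<circ> \<sigma>)"
  proof (rule strict_mono_onI)
    fix a b assume "a \<in> {1..N}" "b \<in> {1..N}" "a < b"
    then show "(x \<circ> \<sigma>) a < (x \<circ> \<sigma>) b"
      using le[of "\<sigma> b" "\<sigma> a"] r\<sigma>[of a] r\<sigma>[of b]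
      by (cases "x (\<sigma> a) < x (\<sigma> b)") (simp_all del: atLeastAtMost_iff)
  qed
  with \<sigma> show ?thesis by (rule that)
qed

section \<open>Independent uniform locations\<close>

abbreviation (input) unit_uniform :: "real measure" where
  "unit_uniform \<equiv> uniform_measure lborel {0..1}"

abbreviation sites :: "nat set \<Rightarrow> (nat \<Rightarrow> real) measure" where
  "sites I \<equiv> PiM I (\<lambda>_. unit_uniform)"

lemma prob_space_unit_uniform: "prob_space unit_uniform"
  by (rule prob_space_uniform_measure) auto

lemma product_prob_space_unit_uniform: "product_prob_space (\<lambda>_::nat. unit_uniform)"
  by (intro product_prob_spaceI prob_space_unit_uniform)

lemma prob_space_sites: "prob_space (sites I)"
  by (intro prob_space_PiM prob_space_unit_uniform)

lemma measurable_site: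
  assumes "i \<in> I"
  shows "(\<lambda>x. x i) \<in> borel_measurable (sites I)"
  using measurable_component_singleton[OF assms, of "\<lambda>_. unit_uniform"]
  by (simp cong: measurable_cong_sets)

lemma integral_unit_uniform:
  fixes f :: "real \<Rightarrow> real"
  assumes [measurable]: "f \<in> borel_measurable borel" and vanish: "\<And>t. t \<notin> {0..1} \<Longrightarrow> f t = 0"
  shows "(\<integral>t. f t \<partial>unit_uniform) = (\<integral>t. f t \<partial>lborel)"
proof -
  have "unit_uniform = density lborel (\<lambda>t. ennreal (indicator {0..1} t))"
    unfolding uniform_measure_def by (intro density_cong) (auto simp: indicator_def)
  then have "(\<integral>t. f t \<partial>unit_uniform) = (\<integral>t. indicator {0..1} t * f t \<partial>lborel)"
    by (simp add: integral_density)
  also have "\<dots> = (\<integral>t. f t \<partial>lborel)"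
    using vanish by (intro Bochner_Integration.integral_cong) (auto simp: indicator_def)
  finally show ?thesis .
qed

text \<open>
  With all other coordinates fixed, the map that sends the coordinate \<open>t\<close> of \<open>k\<close> to \<open>x i + x j - t\<close>
  preserves Lebesgue measure on the line, so the inner integral over \<open>t\<close> equals its own negative.
  The reflection need not map the unit interval to itself; as \<open>F\<close> vanishes when \<open>t\<close> lies outside that
  interval, the uniform distribution of \<open>t\<close> can be replaced by Lebesgue measure.
\<close>

lemma integral_sites_eq_0_if_odd:
  fixes F :: "(nat \<Rightarrow> real) \<Rightarrow> real"
  assumes "finite I" "k \<in> I"
    and meas[measurable]: "F \<in> borel_measurable (sites I)"
    and bounded: "\<And>x. \<bar>F x\<bar> \<le> B"
    and vanish: "\<And>x. x k \<notin> {0..1} \<Longrightarrow> F x = 0"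
    and odd: "\<And>x. F (x(k := x i + x j - x k)) = - F x"
    and "i \<noteq> k" "j \<noteq> k"
  shows "(\<integral>x. F x \<partial>sites I) = 0"
proof -
  interpret product_prob_space "\<lambda>_::nat. unit_uniform"
    by (rule product_prob_space_unit_uniform)
  let ?J = "I - {k}"
  have I: "insert k ?J = I" using assms by auto
  have int: "integrable (sites (insert k ?J)) F"
    unfolding I
    by (rule finite_measure.integrable_const_bound[where B = B,
          OF prob_space.finite_measure[OF prob_space_sites]]) (use bounded in auto)
  have inner: "(\<integral>t. F (x(k := t)) \<partial>unit_uniform) = 0" if x: "x \<in> space (sites ?J)" for x
  proof -
    let ?f = "\<lambda>t. F (x(k := t))"
    have "(\<lambda>t. x(k := t)) \<in> measurable unit_uniform (sites (insert k ?J))"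
      by (rule measurable_component_update[OF x]) simp
    then have "?f \<in> borel_measurable unit_uniform"
      unfolding I by (rule measurable_compose[OF _ meas])
    then have [measurable]: "?f \<in> borel_measurable borel"
      by (simp cong: measurable_cong_sets)
    have eq: "(\<integral>t. ?f t \<partial>unit_uniform) = (\<integral>t. ?f t \<partial>lborel)"
      by (rule integral_unit_uniform) (auto intro: vanish)
    have "(\<integral>t. ?f t \<partial>lborel) = (\<integral>t. ?f ((x i + x j) + (-1) * t) \<partial>lborel)"
      using lborel_integral_real_affine[of "-1" ?f "x i + x j"] by simp
    also have "\<dots> = (\<integral>t. - ?f t \<partial>lborel)"
      using odd[of "x(k := _)"] assms(7,8) by (intro Bochner_Integration.integral_cong) auto
    finally show ?thesis unfolding eq by simp
  qed
  have "(\<integral>x. F x \<partial>sites (insert k ?J)) = (\<integral>x. (\<integral>t. F (x(k := t)) \<partial>unit_uniform) \<partial>sites ?J)"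
    by (rule product_integral_insert[OF _ _ int]) (use assms in auto)
  also have "\<dots> = (\<integral>x. 0 \<partial>sites ?J)"
    by (intro Bochner_Integration.integral_cong) (auto simp: inner)
  finally show ?thesis unfolding I by simp
qed

text \<open>
  For fixed values of the other coordinates, a single value of coordinate \<open>k\<close> is excluded.
\<close>

lemma AE_sites_not_midpoint:
  assumes "finite I" "k \<in> I" "i \<in> I" "j \<in> I" "i \<noteq> k" "j \<noteq> k"
  shows "AE x in sites I. 2 * x k \<noteq> x i + x j"
proof -
  interpret product_prob_space "\<lambda>_::nat. unit_uniform"
    by (rule product_prob_space_unit_uniform)
  let ?J = "I - {k}"
  let ?A = "{x \<in> space (sites I). 2 * x k = x i + x j}"
  have I: "insert k ?J = I" using assms by auto
  note [measurable] = assms(2-4)[THEN measurable_site]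
  have A[measurable]: "?A \<in> sets (sites I)" by measurable
  have "emeasure (sites I) ?A = (\<integral>\<^sup>+x. indicator ?A x \<partial>sites (insert k ?J))"
    unfolding I by simp
  also have "\<dots> = (\<integral>\<^sup>+x. (\<integral>\<^sup>+t. indicator ?A (x(k := t)) \<partial>unit_uniform) \<partial>sites ?J)"
    by (rule product_nn_integral_insert) (use assms A I in auto)
  also have "\<dots> = (\<integral>\<^sup>+x. 0 \<partial>sites ?J)"
  proof (rule nn_integral_cong)
    fix x assume x: "x \<in> space (sites ?J)"
    have "(\<integral>\<^sup>+t. indicator ?A (x(k := t)) \<partial>unit_uniform)
        \<le> (\<integral>\<^sup>+t. indicator {(x i + x j) / 2} t \<partial>unit_uniform)"
      by (rule nn_integral_mono) (use assms in \<open>auto simp: indicator_def\<close>)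
    also have "\<dots> = emeasure unit_uniform {(x i + x j) / 2}"
      by simp
    also have "\<dots> = 0"
      by (subst emeasure_uniform_measure) (auto simp: divide_ennreal_def intro: emeasure_lborel_countable)
    finally show "(\<integral>\<^sup>+t. indicator ?A (x(k := t)) \<partial>unit_uniform) = 0" by simp
  qed
  finally show ?thesis
    using A by (subst AE_iff_measurable[OF A]) auto
qed

text \<open>
  When several servers are at the same distance, the choice among them is arbitrary, but it depends
  only on the set of the nearest servers. That set takes finitely many values, each on an event, and
  so every choice function of it is measurable.
\<close>

lemma measurable_nearest_neighbour:
  assumes i: "i \<in> {1..N}"
  shows "(\<lambda>x. nearest_neighbour N x i) \<in> measurable (sites {1..N}) (count_space UNIV)"
proof -
  let ?S = "{1..N} - {i}" and ?P = "sites {1..N}"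
  define A where "A x = {j \<in> ?S. \<forall>k\<in>?S. dist (x i) (x j) \<le> dist (x i) (x k)}" 
    for x :: "nat \<Rightarrow> real"
  have nn: "nearest_neighbour N x i = (SOME j. j \<in> A x)" for x
    unfolding nearest_neighbour_def arg_min_on_def arg_min_def is_arg_min_linorder A_def
    by (rule arg_cong[where f = Eps]) (auto simp: fun_eq_iff Ball_def)
  have meas_dist: "(\<lambda>x. dist (x i) (x j)) \<in> borel_measurable ?P" if "j \<in> ?S" for j
    using that i by (intro borel_measurable_dist measurable_site) auto
  have minimal: "{x \<in> space ?P. \<forall>k\<in>?S. dist (x i) (x j) \<le> dist (x i) (x k)} \<in> sets ?P"
    if "j \<in> ?S" for j
    using that by (intro sets.sets_Collect_finite_All borel_measurable_le meas_dist) auto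
  have "A \<in> measurable ?P (count_space (Pow ?S))"
  proof (subst measurable_count_space_eq2, simp, intro conjI ballI)
    fix T assume T: "T \<in> Pow ?S"
    have "A -` {T} \<inter> space ?P =
      {x \<in> space ?P. \<forall>j\<in>?S. j \<in> T \<longleftrightarrow> (\<forall>k\<in>?S. dist (x i) (x j) \<le> dist (x i) (x k))}"
      using T unfolding A_def by blast
    also have "\<dots> \<in> sets ?P"
    proof (rule sets.sets_Collect_finite_All)
      fix j assume j: "j \<in> ?S"
      show "{x \<in> space ?P. j \<in> T \<longleftrightarrow> (\<forall>k\<in>?S. dist (x i) (x j) \<le> dist (x i) (x k))} \<in> sets ?P"
        using minimal[OF j] sets.sets_Collect_neg[OF minimal[OF j]] by (cases "j \<in> T") simp_all
    qed simp
    finally show "A -` {T} \<inter> space ?P \<in> sets ?P" .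
  qed (auto simp: A_def)
  then show ?thesis unfolding nn
    by (rule measurable_compose) simp
qed

lemma measurable_overloaded_fraction:
  "(\<lambda>x. overloaded_fraction N p l m x) \<in> borel_measurable (sites {1..N})"
proof -
  let ?P = "sites {1..N}"
  have "(\<lambda>x. effective_rate N p l x i) \<in> borel_measurable ?P" for i
    unfolding effective_rate_def nns_join_def
    by (intro borel_measurable_sum borel_measurable_times borel_measurable_const
        measurable_compose[OF measurable_nearest_neighbour,
          where g = "\<lambda>n. pmf (map_pmf (\<lambda>shift. if shift then n else _) _) i"]) auto
  then have "(\<lambda>x. \<Sum>i\<in>{1..N}. indicator {x \<in> space ?P. m < effective_rate N p l x i} x :: real)
      \<in> borel_measurable ?P"
    by (intro borel_measurable_sum borel_measurable_indicator borel_measurable_less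
        borel_measurable_const) auto
  then have "(\<lambda>x. (\<Sum>i\<in>{1..N}. indicator {x \<in> space ?P. m < effective_rate N p l x i} x) / real N)
      \<in> borel_measurable ?P"
    by (rule borel_measurable_divide) simp
  then show ?thesis
    by (rule measurable_cong[THEN iffD1, rotated])
      (simp add: overloaded_fraction_def indicator_def sum.If_cases Int_def)
qed

section \<open>Cancellation by reflecting one server\<close>

definition sorted_in_unit :: "nat \<Rightarrow> (nat \<Rightarrow> real) \<Rightarrow> bool" where
  "sorted_in_unit N y \<longleftrightarrow> strict_mono_on {1..N} y \<and> y ` {1..N} \<subseteq> {0..1}"

definition reflect :: "nat \<Rightarrow> (nat \<Rightarrow> real) \<Rightarrow> nat \<Rightarrow> real" where
  "reflect c y = y(c := y (c - 1) + y (c + 1) - y c)"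

text \<open>
  The reflected location is again strictly between those of the two adjacent servers, so neither the
  order nor the unit interval is left.
\<close>

lemma sorted_in_unit_reflect:
  assumes "sorted_in_unit N y" and c: "2 \<le> c" "c < N"
  shows "sorted_in_unit N (reflect c y)"
proof -
  have less: "y a < y b" if "1 \<le> a" "a < b" "b \<le> N" for a b
    using assms(1) that by (auto simp: sorted_in_unit_def strict_mono_on_def)
  have le: "y a \<le> y b" if "1 \<le> a" "a \<le> b" "b \<le> N" for a b
    using less[of a b] that by (cases "a = b") auto
  have unit: "0 \<le> y a" "y a \<le> 1" if "1 \<le> a" "a \<le> N" for a
    using assms(1) that by (auto simp: sorted_in_unit_def image_subset_iff)
  have nbr: "y (c - 1) < y c" "y c < y (c + 1)" using less[of "c - 1" c] less[of c "c + 1"] c by auto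
  have "strict_mono_on {1..N} (reflect c y)"
  proof (rule strict_mono_onI)
    fix a b assume ab: "a \<in> {1..N}" "b \<in> {1..N}" "a < b"
    consider "a = c" | "b = c" | "a \<noteq> c" "b \<noteq> c" by blast
    then show "reflect c y a < reflect c y b"
    proof cases
      case 1
      then show ?thesis using le[of "c + 1" b] ab nbr by (simp add: reflect_def)
    next
      case 2
      then have "a \<le> c - 1" "c - 1 \<le> N" using ab c by simp_all
      then have "y a \<le> y (c - 1)" using le[of a "c - 1"] ab by simp
      then show ?thesis using ab nbr 2 by (simp add: reflect_def)
    next
      case 3
      then show ?thesis using less[of a b] ab by (simp add: reflect_def)
    qed
  qed
  moreover have "reflect c y a \<in> {0..1}" if "a \<in> {1..N}" for a
  proof -
    have "0 \<le> y (c - 1)" "y (c + 1) \<le> 1" using c by (auto intro!: unit)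
    then show ?thesis using unit[of a] nbr that by (auto simp: reflect_def)
  qed
  ultimately show ?thesis by (auto simp: sorted_in_unit_def)
qed

lemma reflect_reflect:
  assumes "1 \<le> c"
  shows "reflect c (reflect c y) = y"
  using assms by (auto simp: reflect_def fun_eq_iff)

lemma sorted_in_unit_reflect_iff:
  assumes "2 \<le> c" "c < N"
  shows "sorted_in_unit N (reflect c y) \<longleftrightarrow> sorted_in_unit N y"
  using sorted_in_unit_reflect[OF _ assms, of y] sorted_in_unit_reflect[OF _ assms, of "reflect c y"]
    reflect_reflect[of c y] assms by auto

lemma direction_reflect_centre:
  assumes "2 \<le> c" "c < N"
  shows "direction N (reflect c y) c = - direction N y c"
proof -
  have "2 * (y (c - 1) + y (c + 1) - y c) - (y (c - 1) + y (c + 1)) =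
      - (2 * y c - (y (c - 1) + y (c + 1)))" by simp
  then show ?thesis
    using assms by (simp add: direction_def reflect_def sgn_minus del: sgn_minus) (simp add: sgn_if)
qed

text \<open>
  The direction of a server involves its own location and those of the two adjacent servers only.
\<close>

lemma direction_reflect_away:
  assumes "1 \<le> c" "b \<noteq> c" "b \<noteq> c + 1" "c \<noteq> b + 1"
  shows "direction N (reflect c y) b = direction N y b"
  using assms by (auto simp: direction_def reflect_def)

lemma abs_direction_le_1: "\<bar>direction N y k\<bar> \<le> 1"
  by (simp add: direction_def sgn_if)

lemma comp_fun_upd_perm:
  assumes "inj \<sigma>"
  shows "(x(\<sigma> k := t)) \<circ> \<sigma> = (x \<circ> \<sigma>)(k := t)"
  by (simp add: fun_eq_iff inj_eq[OF assms])

lemma measurable_direction: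
  assumes \<sigma>: "\<sigma> permutes {1..N}"
  shows "(\<lambda>x. direction N (x \<circ> \<sigma>) k) \<in> borel_measurable (sites {1..N})"
proof (cases "2 \<le> k \<and> k < N")
  case True
  then have "\<sigma> k \<in> {1..N}" "\<sigma> (k - 1) \<in> {1..N}" "\<sigma> (k + 1) \<in> {1..N}"
    unfolding permutes_in_image[OF \<sigma>] by auto
  note [measurable] = this[THEN measurable_site]
  have "(\<lambda>x. sgn (2 * x (\<sigma> k) - (x (\<sigma> (k - 1)) + x (\<sigma> (k + 1)))))
      \<in> borel_measurable (sites {1..N})"
    by measurable
  then show ?thesis using True by (simp add: direction_def)
next
  case False
  then have "direction N y k = direction N (\<lambda>_. 0) k" for y
    by (auto simp: direction_def)
  then have "(\<lambda>x. direction N (x \<circ> \<sigma>) k) = (\<lambda>_. direction N (\<lambda>_. 0) k)"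
    by (intro ext)
  then show ?thesis by simp
qed

lemma measurable_sorted_in_unit:
  assumes \<sigma>: "\<sigma> permutes {1..N}"
  shows "(\<lambda>x. of_bool (sorted_in_unit N (x \<circ> \<sigma>)) :: real) \<in> borel_measurable (sites {1..N})"
proof -
  let ?P = "sites {1..N}"
  have site: "(\<lambda>x. x (\<sigma> a)) \<in> borel_measurable ?P" if "a \<in> {1..N}" for a
    using that by (intro measurable_site) (simp only: permutes_in_image[OF \<sigma>])
  have less: "{x \<in> space ?P. a < b \<longrightarrow> x (\<sigma> a) < x (\<sigma> b)} \<in> sets ?P"
    if "a \<in> {1..N}" "b \<in> {1..N}" for a b
    using borel_measurable_less[OF site[OF that(1)] site[OF that(2)]] by (cases "a < b") auto
  have unit: "{x \<in> space ?P. 0 \<le> x (\<sigma> a) \<and> x (\<sigma> a) \<le> 1} \<in> sets ?P" if "a \<in> {1..N}" for a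
    by (intro sets.sets_Collect_conj borel_measurable_le site[OF that] borel_measurable_const)
  have "{x \<in> space ?P. (\<forall>a\<in>{1..N}. \<forall>b\<in>{1..N}. a < b \<longrightarrow> x (\<sigma> a) < x (\<sigma> b)) \<and>
      (\<forall>a\<in>{1..N}. 0 \<le> x (\<sigma> a) \<and> x (\<sigma> a) \<le> 1)} \<in> sets ?P" (is "?A \<in> _")
    by (intro sets.sets_Collect_conj sets.sets_Collect_finite_All less unit) auto
  then have "(\<lambda>x. indicator ?A x :: real) \<in> borel_measurable ?P"
    by (rule borel_measurable_indicator)
  then show ?thesis
    by (rule measurable_cong[THEN iffD1, rotated])
      (auto simp: indicator_def sorted_in_unit_def strict_mono_on_def image_subset_iff)
qed

text \<open>
  The indicator of the region that \<open>\<sigma>\<close> sorts turns ranks into fixed labels: within the region, the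
  server of rank \<open>k\<close> is the server \<open>\<sigma> k\<close>.
\<close>

definition sorted_direction_product :: "nat \<Rightarrow> (nat \<Rightarrow> nat) \<Rightarrow> nat \<Rightarrow> nat \<Rightarrow> (nat \<Rightarrow> real) \<Rightarrow> real" where
  "sorted_direction_product N \<sigma> a b x =
     of_bool (sorted_in_unit N (x \<circ> \<sigma>)) * direction N (x \<circ> \<sigma>) a * direction N (x \<circ> \<sigma>) b"

lemma measurable_sorted_direction_product:
  assumes "\<sigma> permutes {1..N}"
  shows "sorted_direction_product N \<sigma> a b \<in> borel_measurable (sites {1..N})"
  unfolding sorted_direction_product_def
  by (intro borel_measurable_times measurable_sorted_in_unit measurable_direction assms)

lemma abs_sorted_direction_product_le_1: "\<bar>sorted_direction_product N \<sigma> a b x\<bar> \<le> 1"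
  using mult_le_one[OF abs_direction_le_1 abs_ge_zero abs_direction_le_1, of N "x \<circ> \<sigma>" a N "x \<circ> \<sigma>" b]
  by (simp add: sorted_direction_product_def abs_mult)

lemma integrable_sorted_direction_product:
  assumes "\<sigma> permutes {1..N}"
  shows "integrable (sites {1..N}) (sorted_direction_product N \<sigma> a b)"
  by (rule finite_measure.integrable_const_bound[OF prob_space.finite_measure[OF prob_space_sites], where B = 1])
    (rule AE_I2, simp add: abs_sorted_direction_product_le_1, rule measurable_sorted_direction_product[OF assms])

text \<open>
  Reflecting server \<open>\<sigma> c\<close> between its two neighbours preserves the region of \<open>\<sigma>\<close> and changes the sign
  of exactly one of the two factors.
\<close>

lemma integral_sorted_direction_product_interior:
  assumes \<sigma>: "\<sigma> permutes {1..N}" and c: "2 \<le> c" "c < N"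
    and b: "b \<noteq> c" "b \<noteq> c + 1" "c \<noteq> b + 1"
  shows "(\<integral>x. sorted_direction_product N \<sigma> c b x \<partial>sites {1..N}) = 0"
proof (rule integral_sites_eq_0_if_odd[where k = "\<sigma> c" and i = "\<sigma> (c - 1)" and j = "\<sigma> (c + 1)"])
  note inj = permutes_inj[OF \<sigma>]
  show "\<sigma> c \<in> {1..N}" unfolding permutes_in_image[OF \<sigma>] using c by auto
  show "\<sigma> (c - 1) \<noteq> \<sigma> c" "\<sigma> (c + 1) \<noteq> \<sigma> c" using c by (simp_all add: inj_eq[OF inj])
  fix x :: "nat \<Rightarrow> real"
  show "\<bar>sorted_direction_product N \<sigma> c b x\<bar> \<le> 1" by (rule abs_sorted_direction_product_le_1)
  show "sorted_direction_product N \<sigma> c b x = 0" if "x (\<sigma> c) \<notin> {0..1}"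
  proof -
    have "\<not> sorted_in_unit N (x \<circ> \<sigma>)"
      using that c unfolding sorted_in_unit_def by (auto simp: image_subset_iff)
    then show ?thesis by (simp add: sorted_direction_product_def)
  qed
  have "(x(\<sigma> c := x (\<sigma> (c - 1)) + x (\<sigma> (c + 1)) - x (\<sigma> c))) \<circ> \<sigma> = reflect c (x \<circ> \<sigma>)"
    by (simp add: comp_fun_upd_perm[OF inj] reflect_def)
  then show "sorted_direction_product N \<sigma> c b (x(\<sigma> c := x (\<sigma> (c - 1)) + x (\<sigma> (c + 1)) - x (\<sigma> c))) =
      - sorted_direction_product N \<sigma> c b x"
    unfolding sorted_direction_product_def using c b
    by (simp add: sorted_in_unit_reflect_iff direction_reflect_centre direction_reflect_away)
qed (use measurable_sorted_direction_product[OF \<sigma>] in simp_all)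

text \<open>
  The server to reflect is the right one of the pair, of rank \<open>k + 1\<close>, as long as it is interior.
  Otherwise \<open>k \<ge> N - 1\<close>, and then \<open>N \<ge> 4\<close> makes the left one, of rank \<open>k - 1 \<ge> 2\<close>, interior.
\<close>

lemma integral_sorted_direction_product:
  assumes N: "4 \<le> N" and \<sigma>: "\<sigma> permutes {1..N}" and k: "k \<in> {1..N}"
  shows "(\<integral>x. sorted_direction_product N \<sigma> (k - 1) (k + 1) x \<partial>sites {1..N}) = 0"
proof (cases "k + 1 < N")
  case True
  have "sorted_direction_product N \<sigma> (k - 1) (k + 1) = sorted_direction_product N \<sigma> (k + 1) (k - 1)"
    by (simp add: sorted_direction_product_def fun_eq_iff)
  then show ?thesis
    using integral_sorted_direction_product_interior[OF \<sigma>, of "k + 1" "k - 1"] True k by auto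
next
  case False
  then show ?thesis
    using integral_sorted_direction_product_interior[OF \<sigma>, of "k - 1" "k + 1"] N k by auto
qed

section \<open>The expected fraction\<close>

lemma AE_sites_tie_free: "AE x in sites {1..N}. tie_free N x"
  unfolding tie_free_def
  by (intro AE_finite_allI AE_sites_not_midpoint) auto

lemma AE_sites_in_unit: "AE x in sites {1..N}. x ` {1..N} \<subseteq> {0..1}"
proof -
  have "AE x in sites {1..N}. \<forall>i\<in>{1..N}. x i \<in> {0..1}"
  proof (rule AE_finite_allI)
    fix i assume "i \<in> {1..N}"
    then show "AE x in sites {1..N}. x i \<in> {0..1}"
      by (intro AE_PiM_component prob_space_unit_uniform AE_uniform_measureI) auto
  qed simp
  then show ?thesis by eventually_elim auto
qed

lemma tie_free_inj_on:
  assumes "tie_free N x"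
  shows "inj_on x {1..N}"
proof (rule inj_onI, rule ccontr)
  fix i j assume "i \<in> {1..N}" "j \<in> {1..N}" "x i = x j" "i \<noteq> j"
  then have "j \<in> {1..N} - {i}" "2 * x i = x j + x j" by auto
  then show False using assms \<open>i \<in> {1..N}\<close> unfolding tie_free_def by blast
qed

lemma tie_free_perm:
  assumes "tie_free N x" and \<sigma>: "\<sigma> permutes {1..N}"
  shows "tie_free N (x \<circ> \<sigma>)"
  unfolding tie_free_def
proof (intro ballI)
  fix k i j assume "k \<in> {1..N}" "i \<in> {1..N} - {k}" "j \<in> {1..N} - {k}"
  then have "\<sigma> k \<in> {1..N}" "\<sigma> i \<in> {1..N} - {\<sigma> k}" "\<sigma> j \<in> {1..N} - {\<sigma> k}"
    by (simp_all add: permutes_in_image[OF \<sigma>] inj_eq[OF permutes_inj[OF \<sigma>]] del: atLeastAtMost_iff One_nat_def)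
  then show "2 * (x \<circ> \<sigma>) k \<noteq> (x \<circ> \<sigma>) i + (x \<circ> \<sigma>) j"
    using assms(1) unfolding tie_free_def comp_apply by blast
qed

text \<open>
  Exactly one summand on the right survives, the one for the permutation that sorts \<open>x\<close>. Summing
  over all permutations makes every summand a function of \<open>x\<close> with fixed labels, to which the
  reflection argument applies.
\<close>

lemma overloaded_fraction_eq_sum_sorted:
  assumes "0 \<le> p" "p \<le> 1" "l > 0" "m > 0" "N \<ge> 2"
    and load: "1 / (1 + p) < l / m" "l / m \<le> 1"
    and free: "tie_free N x" and unit: "x ` {1..N} \<subseteq> {0..1}"
  shows "overloaded_fraction N p l m x = 1 / 4 -
    (\<Sum>\<sigma> | \<sigma> permutes {1..N}. \<Sum>k=1..N. sorted_direction_product N \<sigma> (k - 1) (k + 1) x)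
      / (4 * real N)"
proof -
  obtain \<sigma> where \<sigma>: "\<sigma> permutes {1..N}" and mono: "strict_mono_on {1..N} (x \<circ> \<sigma>)"
    using sorting_perm_exists[OF tie_free_inj_on[OF free]] by blast
  have "sorted_in_unit N (x \<circ> \<tau>) \<longleftrightarrow> \<tau> = \<sigma>" if \<tau>: "\<tau> permutes {1..N}" for \<tau>
  proof
    assume "sorted_in_unit N (x \<circ> \<tau>)"
    then show "\<tau> = \<sigma>"
      using sorting_perm_unique[OF \<tau> _ \<sigma> mono] by (simp add: sorted_in_unit_def)
  next
    assume "\<tau> = \<sigma>"
    then show "sorted_in_unit N (x \<circ> \<tau>)"
      using mono unit by (simp only: sorted_in_unit_def image_comp[symmetric] permutes_image[OF \<sigma>] simp_thms)
  qed
  then have "(\<Sum>\<tau> | \<tau> permutes {1..N}. \<Sum>k=1..N. sorted_direction_product N \<tau> (k - 1) (k + 1) x) =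
      (\<Sum>\<tau> | \<tau> permutes {1..N}. if \<tau> = \<sigma> then
        \<Sum>k=1..N. direction N (x \<circ> \<tau>) (k - 1) * direction N (x \<circ> \<tau>) (k + 1) else 0)"
    by (intro sum.cong) (auto simp: sorted_direction_product_def)
  also have "\<dots> = (\<Sum>k=1..N. direction N (x \<circ> \<sigma>) (k - 1) * direction N (x \<circ> \<sigma>) (k + 1))"
    using \<sigma> by (subst sum.delta) (auto simp: finite_permutations)
  finally show ?thesis
    using overloaded_fraction_eq_directions[OF assms(1-5) load \<sigma> mono tie_free_perm[OF free \<sigma>]]
    by simp
qed

lemma integral_overloaded_fraction_sites:
  assumes "0 \<le> p" "p \<le> 1" "l > 0" "m > 0" "N \<ge> 4"
    and load: "1 / (1 + p) < l / m" "l / m \<le> 1"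
  shows "(\<integral>x. overloaded_fraction N p l m x \<partial>sites {1..N}) = 1 / 4"
proof -
  interpret prob_space "sites {1..N}" by (rule prob_space_sites)
  let ?F = "\<lambda>x. \<Sum>\<sigma> | \<sigma> permutes {1..N}. \<Sum>k=1..N. sorted_direction_product N \<sigma> (k - 1) (k + 1) x"
  have F: "integrable (sites {1..N}) ?F"
    by (intro Bochner_Integration.integrable_sum integrable_sorted_direction_product) auto
  have "(\<integral>x. ?F x \<partial>sites {1..N}) = (\<Sum>\<sigma> | \<sigma> permutes {1..N}. \<Sum>k=1..N.
      \<integral>x. sorted_direction_product N \<sigma> (k - 1) (k + 1) x \<partial>sites {1..N})"
  proof (subst Bochner_Integration.integral_sum)
    fix \<sigma> assume "\<sigma> \<in> {\<sigma>. \<sigma> permutes {1..N}}"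
    then show "integrable (sites {1..N})
        (\<lambda>x. \<Sum>k=1..N. sorted_direction_product N \<sigma> (k - 1) (k + 1) x)"
      by (intro Bochner_Integration.integrable_sum integrable_sorted_direction_product) auto
  qed (intro sum.cong refl Bochner_Integration.integral_sum integrable_sorted_direction_product, auto)
  also have "\<dots> = 0"
    by (intro sum.neutral ballI integral_sorted_direction_product[OF assms(5)]) auto
  finally have F0: "(\<integral>x. ?F x \<partial>sites {1..N}) = 0" .
  have "AE x in sites {1..N}. overloaded_fraction N p l m x = 1 / 4 - ?F x / (4 * real N)"
    using AE_sites_tie_free AE_sites_in_unit
  proof eventually_elim
    case (elim x)
    then show ?case
      using assms(5) by (intro overloaded_fraction_eq_sum_sorted[OF assms(1-4) _ load]) auto
  qed
  then have "(\<integral>x. overloaded_fraction N p l m x \<partial>sites {1..N}) =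
      (\<integral>x. 1 / 4 - ?F x / (4 * real N) \<partial>sites {1..N})"
    using borel_measurable_integrable[OF F]
    by (intro integral_cong_AE measurable_overloaded_fraction) auto
  also have "\<dots> = (\<integral>x. 1 / 4 \<partial>sites {1..N}) - (\<integral>x. ?F x / (4 * real N) \<partial>sites {1..N})"
    by (intro Bochner_Integration.integral_diff integrable_const integrable_divide_zero impI F)
  also have "\<dots> = 1 / 4"
    unfolding integral_divide_zero F0 by (simp add: prob_space del: One_nat_def)
  finally show ?thesis .
qed

lemma overloaded_fraction_cong:
  assumes "\<And>i. i \<in> {1..N} \<Longrightarrow> x i = y i"
  shows "overloaded_fraction N p l m x = overloaded_fraction N p l m y"
proof -
  have nn: "nearest_neighbour N x i = nearest_neighbour N y i" if "i \<in> {1..N}" for i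
    unfolding nearest_neighbour_def arg_min_on_def arg_min_def is_arg_min_def
    using assms that by (intro arg_cong[where f = Eps]) (auto simp: fun_eq_iff)
  have "effective_rate N p l x i = effective_rate N p l y i" for i
    unfolding effective_rate_def nns_join_def by (intro sum.cong refl) (simp only: nn)
  then show ?thesis by (simp add: overloaded_fraction_def)
qed

theorem theorem2p2:
  fixes M :: "'a measure" and X :: "nat \<Rightarrow> 'a \<Rightarrow> real"
    and N :: nat and p l m :: real
  assumes "prob_space M"
    and "0 \<le> p" and "p \<le> 1" and "l > 0" and "m > 0"
    and "N \<ge> 4"
    and "prob_space.indep_vars M (\<lambda>_. borel) X {1..N}"
    and "\<And>i. i \<in> {1..N} \<Longrightarrow> distr M borel (X i) = uniform_measure lborel {0..1}"
    and "1 / (1 + p) < l / m" and "l / m \<le> 1"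
  shows "(\<integral>\<omega>. overloaded_fraction N p l m (\<lambda>i. X i \<omega>) \<partial>M) = 1 / 4"
proof -
  interpret prob_space M by (rule assms(1))
  let ?P = "PiM {1..N} (\<lambda>_. borel :: real measure)" and ?X = "\<lambda>\<omega>. \<lambda>i\<in>{1..N}. X i \<omega>"
  have rv: "random_variable borel (X i)" if "i \<in> {1..N}" for i
    using assms(7) that by (auto simp: indep_vars_def)
  have "distr M ?P ?X = PiM {1..N} (\<lambda>i. distr M borel (X i))"
    using indep_vars_iff_distr_eq_PiM'[where I = "{1..N}" and X = X and M' = "\<lambda>_. borel"] rv assms(6,7) by auto
  also have "\<dots> = sites {1..N}"
    using assms(8) by (intro PiM_cong) auto
  finally have distr: "distr M ?P ?X = sites {1..N}" .
  have "sets (sites {1..N}) = sets ?P" by (intro sets_PiM_cong) auto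
  then have meas: "overloaded_fraction N p l m \<in> borel_measurable ?P"
    using measurable_overloaded_fraction[of N p l m] by (simp cong: measurable_cong_sets)
  \<comment> \<open>the product space lives on families restricted to the index set\<close>
  have "(\<integral>\<omega>. overloaded_fraction N p l m (\<lambda>i. X i \<omega>) \<partial>M) =
      (\<integral>\<omega>. overloaded_fraction N p l m (?X \<omega>) \<partial>M)"
    by (intro Bochner_Integration.integral_cong overloaded_fraction_cong) auto
  also have "\<dots> = (\<integral>x. overloaded_fraction N p l m x \<partial>distr M ?P ?X)"
    by (rule integral_distr[symmetric, OF _ meas]) (use rv in \<open>intro measurable_restrict, auto\<close>)
  also have "\<dots> = 1 / 4"
    unfolding distr using assms by (intro integral_overloaded_fraction_sites) auto
  finally show ?thesis .
qed

end
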